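(* Let $n\ge 1$ be an integer. Any smooth knot $\mathbb{S}^n\hookrightarrow\mathbb{R}^{n+2}$ is isotopic to an $n$-knot contained in the Menger continuum $M^{n+2}_n$; that is, if $K\subset\mathbb{R}^{n+2}$ is the image of a smooth embedding $\mathbb{S}^n\hookrightarrow\mathbb{R}^{n+2}$, then there is a subset $K'\subset M^{n+2}_n\subset\mathbb{R}^{n+2}$ homeomorphic to $\mathbb{S}^n$ such that $K$ and $K'$ are ambiently isotopic in $\mathbb{R}^{n+2}$.
   Context: An $n$-knot in $\mathbb{R}^{n+2}$ is a subset of $\mathbb{R}^{n+2}$ homeomorphic to the sphere $\mathbb{S}^n$ (equivalently, the image of a topological embedding of $\mathbb{S}^n$); it is smooth if it is the image of a smooth embedding. Menger continuum: let $Q=[0,1]^{n+2}$. Subdivide $Q$ into $3^{n+2}$ congruent closed subcubes indexed by $(a_1,\ldots,a_{n+2})\in\{0,1,2\}^{n+2}$, where $a_i=0,1,2$ means that the $i$-th coordinate ranges over $[0,1/3]$, $[1/3,2/3]$, $[2/3,1]$ respectively. Put $M^{n+2}_n(0)=Q$, and let $M^{n+2}_n(1)$ be the union of those closed subcubes for which at most $n$ of the indices $a_i$ are equal to $1$. The same rule is iterated inside every retained cube: $M^{n+2}_n(r+1)$ is obtained from $M^{n+2}_n(r)$ by replacing each retained closed cube of side $3^{-r}$ by its scaled copy of $M^{n+2}_n(1)$. The Menger continuum is $M^{n+2}_n=\bigcap_{r\ge 0}M^{n+2}_n(r)\subset\mathbb{R}^{n+2}$. Ambient isotopy: two subsets $A,B\subset\mathbb{R}^{n+2}$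 are ambiently isotopic if there is a continuous map $H:\mathbb{R}^{n+2}\times[0,1]\to\mathbb{R}^{n+2}$ such that each $H_t=H(\cdot,t)$ is a homeomorphism of $\mathbb{R}^{n+2}$, $H_0=\mathrm{id}$, and $H_1(A)=B$. *)

theory Defs
  imports "HOL-Analysis.Analysis"
begin

text \<open>On a finite-dimensional domain and an open set \<open>S\<close>, requiring every directional
  derivative \<open>x \<mapsto> Df(x)v\<close> to be \<open>k\<close> times continuously differentiable is the usual \<open>C\<^sup>k\<close>
  recursion, without passing to the space of linear maps.\<close>

primrec higher_differentiable_on ::
  "nat \<Rightarrow> 'a::euclidean_space set \<Rightarrow> ('a \<Rightarrow> 'b::euclidean_space) \<Rightarrow> bool" where
  "higher_differentiable_on 0 S f \<longleftrightarrow> continuous_on S f"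
| "higher_differentiable_on (Suc k) S f \<longleftrightarrow>
     (\<forall>x\<in>S. f differentiable (at x)) \<and>
     (\<forall>v. higher_differentiable_on k S (\<lambda>x. frechet_derivative f (at x) v))"

definition smooth_on ::
  "'a::euclidean_space set \<Rightarrow> ('a \<Rightarrow> 'b::euclidean_space) \<Rightarrow> bool" where
  "smooth_on S f \<longleftrightarrow> (\<forall>k. higher_differentiable_on k S f)"

text \<open>Smooth embedding of the standard unit sphere: a smooth immersion that is a homeomorphism
  onto its image. Smoothness on the sphere means having a smooth extension \<open>F\<close> to an open
  neighbourhood \<open>U\<close>; the tangent space at \<open>x\<close> is the orthogonal complement of \<open>x\<close>, and the
  restriction of \<open>DF(x)\<close> to it does not depend on the choice of \<open>F\<close>. Values of \<open>f\<close> off the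
  sphere are irrelevant.\<close>

definition smooth_sphere_embedding ::
  "('a::euclidean_space \<Rightarrow> 'b::euclidean_space) \<Rightarrow> bool" where
  "smooth_sphere_embedding f \<longleftrightarrow>
     (\<exists>U F. open U \<and> sphere 0 1 \<subseteq> U \<and> smooth_on U F \<and>
        (\<forall>x\<in>sphere 0 1. F x = f x) \<and>
        (\<forall>x\<in>sphere 0 1. inj_on (frechet_derivative F (at x)) {v. x \<bullet> v = 0})) \<and>
     (\<exists>g. homeomorphism (sphere 0 1) (f ` sphere 0 1) f g)"

text \<open>Lower corners of the retained cubes of side \<open>3\<^sup>-\<^sup>r\<close>; \<open>a i\<close> selects the third
  (\<open>0\<close>, \<open>1\<close> or \<open>2\<close>) of the cube in coordinate \<open>i\<close>. The ambient dimension is the cardinality of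
  the index type, and \<open>n\<close> bounds the number of middle thirds.\<close>

primrec menger_corners :: "nat \<Rightarrow> nat \<Rightarrow> (real ^ 'd) set" where
  "menger_corners n 0 = {0}"
| "menger_corners n (Suc r) =
     {c + (1/3) ^ Suc r *\<^sub>R (\<chi> i. real (a i)) | c (a :: 'd \<Rightarrow> nat).
        c \<in> menger_corners n r \<and> (\<forall>i. a i \<in> {0, 1, 2}) \<and> card {i. a i = 1} \<le> n}"

definition menger_stage :: "nat \<Rightarrow> nat \<Rightarrow> (real ^ 'd) set" where
  "menger_stage n r = (\<Union>c\<in>menger_corners n r. cbox c (c + (\<chi> i. (1/3) ^ r)))"

definition menger_continuum :: "nat \<Rightarrow> (real ^ 'd) set" where
  "menger_continuum n = (\<Inter>r. menger_stage n r)"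

definition ambient_isotopic :: "'a::topological_space set \<Rightarrow> 'a set \<Rightarrow> bool" where
  "ambient_isotopic A B \<longleftrightarrow>
     (\<exists>H :: 'a \<times> real \<Rightarrow> 'a.
        continuous_on (UNIV \<times> {0..1}) H \<and>
        (\<forall>t\<in>{0..1}. \<exists>g. homeomorphism UNIV UNIV (\<lambda>x. H (x, t)) g) \<and>
        (\<forall>x. H (x, 0) = x) \<and>
        (\<lambda>x. H (x, 1)) ` A = B)"

end

theory Submission imports Defs begin

text \<open>Membership in the Menger continuum only asks that at every scale at most \<open>n\<close> coordinates
  fall into a middle third, so its complement in the unit cube is a union of tubes around lines
  parallel to the axes. By Sard-type negligibility, a generic translate of \<open>K\<close> has at most \<open>n\<close>
  rational coordinates at each of its points, hence misses all lines whose other coordinates are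
  rational. One subdivides the line recursively at rational points, taking at each step the middle
  pieces so thin around rational midpoints that, by compactness, \<open>K\<close> misses the corresponding
  tubes. The increasing homeomorphism of the line that carries these subdivisions to the triadic
  ones, applied in every coordinate, moves \<open>K\<close> into the Menger continuum, and it is joined to the
  identity by convex combination.\<close>

section \<open>Triadic addresses of points of the Menger continuum\<close>

text \<open>The residue of \<open>N (Suc r) i\<close> modulo 3 is the digit choosing a third in
  coordinate \<open>i\<close>, so by induction the points with coordinates
  \<open>N r i / 3 ^ r\<close> are retained corners. The address \<open>N\<close> is a parameter,
  not a floor of \<open>y\<close>, because a point on a common face of closed cubes has several
  addresses.\<close>

lemma menger_continuumI:
  fixes y :: "real ^ 'd" and N :: "nat \<Rightarrow> 'd \<Rightarrow> int"
  assumes N0: "\<And>i. N 0 i = 0"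
    and div3: "\<And>r i. N (Suc r) i div 3 = N r i"
    and middle: "\<And>r. card {i. N (Suc r) i mod 3 = 1} \<le> n"
    and lower: "\<And>r i. of_int (N r i) / 3 ^ r \<le> y $ i"
    and upper: "\<And>r i. y $ i \<le> (of_int (N r i) + 1) / 3 ^ r"
  shows "y \<in> menger_continuum n"
proof -
  have corner: "(\<chi> i. of_int (N r i) / 3 ^ r) \<in> menger_corners n r" for r
  proof (induction r)
    case 0
    then show ?case by (simp add: N0 vec_eq_iff)
  next
    case (Suc r)
    define a where "a i = nat (N (Suc r) i mod 3)" for i
    have "N (Suc r) i = 3 * N r i + int (a i)" for i
      using div3[of r i] div_mult_mod_eq[of "N (Suc r) i" 3] unfolding a_def by simp
    then have "real_of_int (N (Suc r) i) = 3 * of_int (N r i) + real (a i)" for i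
      by simp
    then have eq: "(\<chi> i. of_int (N (Suc r) i) / 3 ^ Suc r) =
        (\<chi> i. of_int (N r i) / 3 ^ r) + (1/3) ^ Suc r *\<^sub>R (\<chi> i. real (a i))"
      by (simp add: vec_eq_iff field_simps)
    have dig: "a i \<in> {0, 1, 2}" for i
    proof -
      have "N (Suc r) i mod 3 \<in> {0,1,2}" by auto
      then show ?thesis unfolding a_def by auto
    qed
    have "{i. a i = 1} = {i. N (Suc r) i mod 3 = 1}"
      unfolding a_def by auto
    then have "card {i. a i = 1} \<le> n"
      using middle by simp
    with eq dig Suc show ?case
      unfolding menger_corners.simps by blast
  qed
  have "y \<in> menger_stage n r" for r
  proof -
    have "y \<in> cbox (\<chi> i. of_int (N r i) / 3 ^ r) ((\<chi> i. of_int (N r i) / 3 ^ r) + (\<chi> i. (1/3) ^ r))"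
      using lower[of r] upper[of _ r] by (simp add: mem_box_cart add_divide_distrib power_one_over)
    with corner show ?thesis
      unfolding menger_stage_def by blast
  qed
  then show ?thesis
    by (simp add: menger_continuum_def)
qed

section \<open>Generic translates\<close>

text \<open>A translate is bad if it moves some \<open>f x\<close> onto an axis-parallel line
  through a point of the countable set \<open>C\<close>. For each such line the bad translates form
  a differentiable image of sphere times line, a null set in a space of dimension
  \<open>CARD('d)\<close>. Countably many null sets do not cover the space. Avoiding them leaves at
  least two coordinates outside \<open>D\<close>.\<close>

lemma generic_translate_avoids_countable:
  fixes f :: "real ^ 'm \<Rightarrow> real ^ 'd" and D :: "real set"
  assumes dim: "CARD('d) = CARD('m) + 1"
    and diff: "\<And>x. x \<in> sphere 0 1 \<Longrightarrow> f differentiable (at x)"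
    and "countable D"
  shows "\<exists>v. \<forall>x\<in>sphere 0 1. \<forall>i. \<exists>j. j \<noteq> i \<and> f x $ j + v $ j \<notin> D"
proof -
  define C where "C = {q :: real ^ 'd. \<forall>j. q $ j \<in> D}"
  have "countable C"
    unfolding C_def by (rule countable_vector) (use assms in auto)
  \<comment> \<open>With \<open>v = g q i (x, s)\<close>, the point \<open>f x + v\<close> is
    \<open>q\<close> shifted by \<open>s\<close> along axis \<open>i\<close>.\<close>
  define g where "g q i p = q - f (fst p) + snd p *\<^sub>R axis i 1" for q i and p :: "(real ^ 'm) \<times> real"
  define bad where "bad q i = g q i ` (sphere 0 1 \<times> UNIV)" for q i
  have sph: "negligible (sphere (0 :: real ^ 'm) 1 \<times> (UNIV :: real set))"
  proof -
    have "frontier (cball (0 :: real ^ 'm) 1 \<times> (UNIV :: real set)) = sphere 0 1 \<times> UNIV"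
      by (auto simp: frontier_def closure_Times interior_Times)
    moreover have "convex (cball (0 :: real ^ 'm) 1 \<times> (UNIV :: real set))"
      by (intro convex_Times) auto
    ultimately show ?thesis
      using negligible_convex_frontier by metis
  qed
  have neg: "negligible (bad q i)" for q i
    unfolding bad_def
  proof (rule negligible_differentiable_image_negligible[OF _ sph])
    show "DIM((real ^ 'm) \<times> real) \<le> DIM(real ^ 'd)"
      using dim by simp
    show "g q i differentiable_on sphere 0 1 \<times> UNIV"
      unfolding differentiable_on_def
    proof
      fix p :: "(real ^ 'm) \<times> real"
      assume "p \<in> sphere 0 1 \<times> UNIV"
      then have "f differentiable (at (fst p))"
        using diff by auto
      then have "(\<lambda>p. f (fst p)) differentiable (at p)"
        using differentiable_chain_at[of fst p f]
        by (auto simp: o_def bounded_linear_fst bounded_linear_imp_differentiable)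
      moreover have "(\<lambda>p :: (real ^ 'm) \<times> real. snd p *\<^sub>R axis i (1::real)) differentiable (at p)"
        by (intro bounded_linear_imp_differentiable bounded_linear_intros)
      ultimately have "g q i differentiable (at p)"
        unfolding g_def by (intro differentiable_add differentiable_diff) auto
      then show "g q i differentiable (at p within sphere 0 1 \<times> UNIV)"
        by (rule differentiable_at_withinI)
    qed
  qed
  have "negligible (\<Union>(case_prod bad ` (C \<times> UNIV)))"
    using \<open>countable C\<close> neg by (intro negligible_countable_Union) auto
  then have "(\<Union>(case_prod bad ` (C \<times> UNIV))) \<noteq> UNIV"
    using non_negligible_UNIV by metis
  then obtain v where v: "v \<notin> (\<Union>(case_prod bad ` (C \<times> UNIV)))"
    by blast
  have "\<exists>j. j \<noteq> i \<and> f x $ j + v $ j \<notin> D" if x: "x \<in> sphere 0 1" for x i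
  proof (rule ccontr)
    assume "\<not> ?thesis"
    then have inD: "f x $ j + v $ j \<in> D" if "j \<noteq> i" for j
      using that by blast
    have "card {i} \<noteq> CARD('d)"
      using dim by simp
    then obtain j0 where "j0 \<noteq> i"
      by (metis UNIV_eq_I singletonI)
    with inD have "D \<noteq> {}" by blast
    then obtain d where "d \<in> D" by blast
    \<comment> \<open>Coordinate \<open>i\<close> is unconstrained; putting \<open>d\<close> there
      places \<open>q\<close> in \<open>C\<close>, and the line parameter absorbs the
      difference.\<close>
    define q where "q = (\<chi> j. if j = i then d else f x $ j + v $ j)"
    have "q \<in> C"
      using \<open>d \<in> D\<close> inD by (auto simp: C_def q_def)
    moreover have "v = g q i (x, f x $ i + v $ i - d)"
      by (auto simp: g_def q_def vec_eq_iff axis_def)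
    then have "v \<in> bad q i"
      using x unfolding bad_def by blast
    ultimately show False
      using v by blast
  qed
  then show ?thesis by blast
qed

section \<open>Rational subdivisions of the line with thin middle pieces\<close>

text \<open>The points with more than \<open>n\<close> coordinates in \<open>range q\<close> form a
  closed set, because \<open>range q\<close> is uniformly discrete. It misses the compact
  \<open>K\<close>, hence has positive distance from it. A point of \<open>K\<close> with more than
  \<open>n\<close> coordinates near \<open>range q\<close> could be moved into that set by too small
  a shift.\<close>

lemma thin_middle_intervals:
  fixes K :: "(real ^ 'd) set" and q :: "int \<Rightarrow> real"
  assumes "compact K" and "m > 0" and gap: "\<And>k. q (k + 1) - q k \<ge> m"
    and few: "\<And>x. x \<in> K \<Longrightarrow> card {i. x $ i \<in> range q} \<le> n"
  shows "\<exists>e>0. \<forall>x\<in>K. card {i. \<exists>k. \<bar>x $ i - q k\<bar> \<le> e} \<le> n"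
proof -
  have far: "q l - q k \<ge> m * (l - k)" if "k \<le> l" for k l
    using that
  proof (induction l rule: int_ge_induct)
    case (step l)
    then show ?case using gap[of l] by (simp add: algebra_simps)
  qed simp
  have sep: "m \<le> dist (q k) (q l)" if "k < l" for k l
  proof -
    have "m * 1 \<le> m * real_of_int (l - k)"
      using that \<open>m > 0\<close> by (intro mult_left_mono) auto
    then show ?thesis
      using far[of k l] that by (simp add: dist_real_def)
  qed
  have "\<forall>x\<in>range q. \<forall>y\<in>range q. dist y x < m \<longrightarrow> y = x"
  proof (clarify)
    fix k l assume "dist (q k) (q l) < m"
    then show "q k = q l"
      using sep[of k l] sep[of l k] by (cases k l rule: linorder_cases) (auto simp: dist_commute)
  qed
  then have "closed (range q)"
    using discrete_imp_closed[OF \<open>m > 0\<close>] by blast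
  define Z where "Z = (\<Union>S\<in>{S. n < card S}. {x :: real ^ 'd. \<forall>i\<in>S. x $ i \<in> range q})"
  have "closed {x :: real ^ 'd. \<forall>i\<in>S. x $ i \<in> range q}" for S
  proof -
    have "closed {x :: real ^ 'd. x $ i \<in> range q}" for i
      using continuous_closed_vimage[OF \<open>closed (range q)\<close>, of "\<lambda>x :: real ^ 'd. x $ i"]
      by (simp add: vimage_def)
    then have "closed (\<Inter>i\<in>S. {x :: real ^ 'd. x $ i \<in> range q})"
      by blast
    then show ?thesis
      by (simp add: Inter_eq)
  qed
  then have "closed Z"
    unfolding Z_def by (intro closed_UN) auto
  have "K \<inter> Z = {}"
  proof (rule ccontr)
    assume "K \<inter> Z \<noteq> {}"
    then obtain x S where x: "x \<in> K" "n < card S" "\<forall>i\<in>S. x $ i \<in> range q"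
      unfolding Z_def by blast
    then have "card S \<le> card {i. x $ i \<in> range q}"
      by (intro card_mono) auto
    with few x show False by fastforce
  qed
  then obtain d where "d > 0" and d: "\<And>x y. x \<in> K \<Longrightarrow> y \<in> Z \<Longrightarrow> d \<le> dist x y"
    using separate_compact_closed[OF \<open>compact K\<close> \<open>closed Z\<close>] by blast
  \<comment> \<open>Changing every coordinate by at most \<open>e\<close> moves a point by at most
    \<open>d / 2\<close> in the l1 norm, which dominates the Euclidean one.\<close>
  define e where "e = d / (2 * real CARD('d))"
  have "e > 0"
    using \<open>d > 0\<close> by (simp add: e_def)
  moreover have "card {i. \<exists>k. \<bar>x $ i - q k\<bar> \<le> e} \<le> n" if "x \<in> K" for x
  proof (rule ccontr)
    define S where "S = {i. \<exists>k. \<bar>x $ i - q k\<bar> \<le> e}"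
    assume "\<not> ?thesis"
    then have "n < card S"
      by (simp add: S_def)
    have "\<forall>i\<in>S. \<exists>k. \<bar>x $ i - q k\<bar> \<le> e"
      by (simp add: S_def)
    then obtain k where k: "\<And>i. i \<in> S \<Longrightarrow> \<bar>x $ i - q (k i)\<bar> \<le> e"
      by metis
    define y where "y = (\<chi> i. if i \<in> S then q (k i) else x $ i)"
    have "y \<in> Z"
      using \<open>n < card S\<close> unfolding Z_def y_def by auto
    have "dist x y \<le> (\<Sum>i\<in>UNIV. \<bar>(x - y) $ i\<bar>)"
      unfolding dist_norm by (rule norm_le_l1_cart)
    also have "\<dots> \<le> (\<Sum>i\<in>(UNIV :: 'd set). e)"
      using k \<open>e > 0\<close> by (intro sum_mono) (auto simp: y_def)
    also have "\<dots> = d / 2"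
      by (simp add: e_def)
    finally show False
      using d[OF that \<open>y \<in> Z\<close>] \<open>d > 0\<close> by simp
  qed
  ultimately show ?thesis by blast
qed

text \<open>Both bounds are uniform over infinitely many \<open>k\<close>: a positive
  \<open>m\<close> keeps the midpoints uniformly discrete for the next subdivision, and
  \<open>M\<close> controls the mesh.\<close>

definition gaps_in :: "real \<Rightarrow> real \<Rightarrow> (int \<Rightarrow> real) \<Rightarrow> bool" where
  "gaps_in m M g \<longleftrightarrow> (\<forall>k. m \<le> g (k + 1) - g k \<and> g (k + 1) - g k \<le> M)"

text \<open>Midpoints of rational intervals are rational, so \<open>few\<close> limits how many
  coordinates of a point of \<open>K\<close> can hit them; by compactness one common half-width
  works for all middle pieces.\<close>

lemma subdivision_step:
  fixes K :: "(real ^ 'd) set"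
  assumes "compact K" and few: "\<And>x. x \<in> K \<Longrightarrow> card {i. x $ i \<in> \<rat>} \<le> n"
    and rat: "range g \<subseteq> \<rat>" and "m > 0" and gaps: "gaps_in m M g"
  shows "\<exists>g'. range g' \<subseteq> \<rat> \<and> (\<exists>m'>0. gaps_in m' (M / 2) g') \<and> (\<forall>k. g' (3 * k) = g k) \<and>
    (\<forall>x\<in>K. card {i. \<exists>k. g' (3 * k + 1) \<le> x $ i \<and> x $ i \<le> g' (3 * k + 2)} \<le> n)"
proof -
  define q where "q k = (g k + g (k + 1)) / 2" for k
  have q_rat: "q k \<in> \<rat>" for k
    using rat unfolding q_def by (intro Rats_divide Rats_add) auto
  have "q (k + 1) - q k \<ge> m" for k
  proof -
    have "m \<le> g (k + 1) - g k" "m \<le> g (k + 1 + 1) - g (k + 1)"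
      using gaps unfolding gaps_in_def by blast+
    then show ?thesis
      by (simp add: q_def field_simps)
  qed
  moreover have "card {i. x $ i \<in> range q} \<le> n" if "x \<in> K" for x
  proof -
    have "card {i. x $ i \<in> range q} \<le> card {i. x $ i \<in> \<rat>}"
      using q_rat by (intro card_mono) auto
    with few[OF that] show ?thesis by simp
  qed
  ultimately obtain e0 where "e0 > 0"
    and e0: "\<And>x. x \<in> K \<Longrightarrow> card {i. \<exists>k. \<bar>x $ i - q k\<bar> \<le> e0} \<le> n"
    using thin_middle_intervals[OF \<open>compact K\<close> \<open>m > 0\<close>] by metis
  \<comment> \<open>A rational \<open>e\<close> keeps the new endpoints rational. Since
    \<open>e < m / 4\<close>, the outer pieces have length at least \<open>m / 4\<close> and the
    middle ones at most \<open>M / 2\<close>.\<close>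
  obtain e where e: "e \<in> \<rat>" "0 < e" "e < min e0 (m / 4)"
    using Rats_dense_in_real[of 0 "min e0 (m / 4)"] \<open>e0 > 0\<close> \<open>m > 0\<close> by auto
  define g' where "g' j = (if j mod 3 = 0 then g (j div 3)
    else if j mod 3 = 1 then q (j div 3) - e else q (j div 3) + e)" for j
  have g'[simp]: "g' (3 * k) = g k" "g' (3 * k + 1) = q k - e" "g' (3 * k + 2) = q k + e" for k
    by (simp_all add: g'_def)
  have "range g' \<subseteq> \<rat>"
    using rat q_rat e by (auto simp: g'_def)
  moreover have "gaps_in (min (2 * e) (m / 4)) (M / 2) g'"
    unfolding gaps_in_def
  proof
    fix j :: int
    define k where "k = j div 3"
    have bounds: "m \<le> g (k + 1) - g k" "g (k + 1) - g k \<le> M"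
      using gaps by (auto simp: gaps_in_def)
    have "j = 3 * k \<or> j = 3 * k + 1 \<or> j = 3 * k + 2"
      unfolding k_def by presburger
    moreover have "g' (3 * k + 3) = g (k + 1)"
      using g'(1)[of "k + 1"] by (simp add: algebra_simps)
    moreover have "2 * q k = g k + g (k + 1)"
      by (simp add: q_def)
    ultimately show "min (2 * e) (m / 4) \<le> g' (j + 1) - g' j \<and> g' (j + 1) - g' j \<le> M / 2"
      using bounds e by (elim disjE) (simp_all add: add.assoc min_le_iff_disj)
  qed
  moreover have "card {i. \<exists>k. g' (3 * k + 1) \<le> x $ i \<and> x $ i \<le> g' (3 * k + 2)} \<le> n"
    if "x \<in> K" for x
  proof -
    have "card {i. \<exists>k. g' (3 * k + 1) \<le> x $ i \<and> x $ i \<le> g' (3 * k + 2)}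
        \<le> card {i. \<exists>k. \<bar>x $ i - q k\<bar> \<le> e0}"
    proof (intro card_mono)
      show "{i. \<exists>k. g' (3 * k + 1) \<le> x $ i \<and> x $ i \<le> g' (3 * k + 2)}
          \<subseteq> {i. \<exists>k. \<bar>x $ i - q k\<bar> \<le> e0}"
      proof safe
        fix i k assume "g' (3 * k + 1) \<le> x $ i" "x $ i \<le> g' (3 * k + 2)"
        then have "\<bar>x $ i - q k\<bar> \<le> e0"
          using e by auto
        then show "\<exists>k. \<bar>x $ i - q k\<bar> \<le> e0" ..
      qed
    qed simp
    with e0[OF that] show ?thesis by simp
  qed
  moreover have "min (2 * e) (m / 4) > 0"
    using e \<open>m > 0\<close> by simp
  ultimately show ?thesis
    using g'(1) by blast
qed

text \<open>Dependent choice iterates the previous step. The initial cell of index 0 is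
  \<open>[-L, L]\<close>, destined for the unit interval.\<close>

lemma subdivision_sequence:
  fixes K :: "(real ^ 'd) set"
  assumes "compact K" and "\<And>x. x \<in> K \<Longrightarrow> card {i. x $ i \<in> \<rat>} \<le> n" and "L \<in> \<rat>" "L > 0"
  obtains h where "\<And>k. h 0 k = 2 * L * of_int k - L"
    and "\<And>r k. h (Suc r) (3 * k) = h r k"
    and "\<And>r k. h r k < h r (k + 1)"
    and "\<And>r k. h r (k + 1) - h r k \<le> 2 * L / 2 ^ r"
    and "\<And>r x. x \<in> K \<Longrightarrow>
      card {i. \<exists>k. h (Suc r) (3 * k + 1) \<le> x $ i \<and> x $ i \<le> h (Suc r) (3 * k + 2)} \<le> n"
proof -
  \<comment> \<open>\<open>P\<close> carries what the next step needs: rational endpoints and a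
    positive lower gap bound, which may shrink with \<open>r\<close>.\<close>
  define P where "P r g \<longleftrightarrow> range g \<subseteq> \<rat> \<and> (\<exists>m>0. gaps_in m (2 * L / 2 ^ r) g) \<and>
    (r = 0 \<longrightarrow> g = (\<lambda>k. 2 * L * of_int k - L))" for r :: nat and g
  define Q where "Q g g' \<longleftrightarrow> (\<forall>k. g' (3 * k) = g k) \<and>
    (\<forall>x\<in>K. card {i. \<exists>k. g' (3 * k + 1) \<le> x $ i \<and> x $ i \<le> g' (3 * k + 2)} \<le> n)"
    for g g' :: "int \<Rightarrow> real"
  have "\<exists>g. P 0 g"
    using \<open>L \<in> \<rat>\<close> \<open>L > 0\<close>
    by (intro exI[of _ "\<lambda>k. 2 * L * of_int k - L"])
      (auto simp: P_def gaps_in_def algebra_simps intro!: exI[of _ "2 * L"])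
  moreover have "\<exists>g'. P (Suc r) g' \<and> Q g g'" if P: "P r g" for r g
  proof -
    obtain m where m: "range g \<subseteq> \<rat>" "m > 0" "gaps_in m (2 * L / 2 ^ r) g"
      using P unfolding P_def by blast
    have half: "2 * L / 2 ^ Suc r = 2 * L / 2 ^ r / 2"
      by simp
    show ?thesis
      using subdivision_step[OF assms(1,2) m]
      unfolding P_def Q_def half by auto
  qed
  ultimately have "\<exists>h. \<forall>r. P r (h r) \<and> Q (h r) (h (Suc r))"
    by (rule dependent_nat_choice[where Q = "\<lambda>_. Q"])
  then obtain h where P: "\<And>r. P r (h r)" and Q: "\<And>r. Q (h r) (h (Suc r))"
    by blast
  have gaps: "h r k < h r (k + 1) \<and> h r (k + 1) - h r k \<le> 2 * L / 2 ^ r" for r k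
    using P[of r] unfolding P_def gaps_in_def by (metis diff_gt_0_iff_gt less_le_trans)
  show thesis
    using that[of h] P[of 0] Q gaps unfolding P_def Q_def by simp
qed


section \<open>The increasing homeomorphism onto the triadic subdivision\<close>

lemma triadic_dense:
  assumes "a < (b :: real)"
  obtains r :: nat and k :: int where "a < of_int k / 3 ^ r" "of_int k / 3 ^ r < b"
proof -
  obtain r where r: "(1 / 3) ^ r < b - a"
    using real_arch_pow_inv[of "b - a" "1 / 3"] assms by auto
  have "a * 3 ^ r < of_int (\<lfloor>a * 3 ^ r\<rfloor> + 1)" "of_int (\<lfloor>a * 3 ^ r\<rfloor> + 1) \<le> a * 3 ^ r + 1"
    by linarith+
  moreover have "a * 3 ^ r + 1 < b * 3 ^ r"
    using r by (simp add: field_simps power_one_over)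
  ultimately have "a * 3 ^ r < of_int (\<lfloor>a * 3 ^ r\<rfloor> + 1)" "of_int (\<lfloor>a * 3 ^ r\<rfloor> + 1) < b * 3 ^ r"
    by linarith+
  then show thesis
    using that[of "\<lfloor>a * 3 ^ r\<rfloor> + 1" r] by (simp add: pos_less_divide_eq pos_divide_less_eq)
qed

text \<open>A monotone function can only be discontinuous by jumping, and a jump would omit
  values.\<close>

lemma surj_imp_continuous_on:
  fixes f :: "real \<Rightarrow> real"
  assumes "mono f" "surj f"
  shows "continuous_on UNIV f"
  using assms by (intro continuous_onI_mono) (auto dest: monoD)

text \<open>The compact set is forgotten here; \<open>h r k\<close> is to correspond to
  \<open>k / 3 ^ r\<close>.\<close>

locale triadic_subdivision =
  fixes h :: "nat \<Rightarrow> int \<Rightarrow> real" and L :: real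
  assumes L_pos: "L > 0"
    and start: "\<And>k. h 0 k = 2 * L * of_int k - L"
    and refine: "\<And>r k. h (Suc r) (3 * k) = h r k"
    and increasing: "\<And>r k. h r k < h r (k + 1)"
    and gap_le: "\<And>r k. h r (k + 1) - h r k \<le> 2 * L / 2 ^ r"
begin

lemma strict_mono_h: "strict_mono (h r)"
proof (rule strict_monoI)
  fix k l :: int
  assume "k < l"
  then have "k + 1 \<le> l" by simp
  then show "h r k < h r l"
  proof (induction l rule: int_ge_induct)
    case (step l)
    then show ?case using increasing[of r l] by simp
  qed (rule increasing)
qed

lemma h_refine_iterate: "h (r + s) (3 ^ s * k) = h r k"
proof (induction s)
  case (Suc s)
  then show ?case
    using refine[of "r + s" "3 ^ s * k"] by (simp add: mult.assoc)
qed simp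

text \<open>Both points are endpoints at the common level \<open>r + s\<close>, where order is order
  of indices. Hence the correspondence with triadic rationals is well defined and preserves
  order.\<close>

lemma h_le_h_iff: "h r k \<le> h s l \<longleftrightarrow> (of_int k :: real) / 3 ^ r \<le> of_int l / 3 ^ s"
proof -
  have "h r k \<le> h s l \<longleftrightarrow> h (r + s) (3 ^ s * k) \<le> h (r + s) (3 ^ r * l)"
    using h_refine_iterate[of r s k] h_refine_iterate[of s r l] by (simp add: add.commute)
  also have "\<dots> \<longleftrightarrow> 3 ^ s * k \<le> 3 ^ r * l"
    by (rule strict_mono_less_eq[OF strict_mono_h])
  also have "\<dots> \<longleftrightarrow> real_of_int (3 ^ s * k) \<le> real_of_int (3 ^ r * l)"
    by (rule of_int_le_iff[symmetric])
  also have "\<dots> \<longleftrightarrow> (of_int k :: real) / 3 ^ r \<le> of_int l / 3 ^ s"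
    by (simp add: field_simps)
  finally show ?thesis .
qed

lemma cell_exists: "\<exists>k. h r k \<le> x \<and> x < h r (k + 1)"
proof (induction r)
  case 0
  define k where "k = \<lfloor>(x + L) / (2 * L)\<rfloor>"
  have "of_int k \<le> (x + L) / (2 * L)" "(x + L) / (2 * L) < of_int k + 1"
    unfolding k_def by linarith+
  then have "h 0 k \<le> x \<and> x < h 0 (k + 1)"
    using L_pos by (simp add: start field_simps)
  then show ?case ..
next
  case (Suc r)
  then obtain k where "h (Suc r) (3 * k) \<le> x" "x < h (Suc r) (3 * (k + 1))"
    unfolding refine by blast
  \<comment> \<open>Three unit steps cross the parent cell; comparing \<open>x\<close> with the two
    inner endpoints finds its child cell.\<close>
  moreover have "3 * (k + 1) = 3 * k + 1 + 1 + 1"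
    by simp
  ultimately show ?case
    by (metis linorder_not_le)
qed

text \<open>The monotone extension of \<open>h r k\<close> mapping to \<open>k / 3 ^ r\<close>. The
  bounds \<open>phi_ge\<close> and \<open>phi_le\<close> give these values exactly and suffice for
  all later arguments.\<close>

definition phi :: "real \<Rightarrow> real" where
  "phi x = Sup {of_int k / 3 ^ r | r k. h r k \<le> x}"

lemma phi_ge: "of_int k / 3 ^ r \<le> phi x" if "h r k \<le> x"
proof -
  obtain l where l: "x < h 0 (l + 1)"
    using cell_exists[of 0] by blast
  have "bdd_above {real_of_int k / 3 ^ r | r k. h r k \<le> x}"
  proof (rule bdd_aboveI)
    fix t assume "t \<in> {real_of_int k / 3 ^ r | r k. h r k \<le> x}"
    then obtain k r where "t = real_of_int k / 3 ^ r" "h r k \<le> x"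
      by blast
    with l show "t \<le> real_of_int (l + 1) / 3 ^ 0"
      using h_le_h_iff[of r k 0 "l + 1"] by simp
  qed
  then show ?thesis
    unfolding phi_def using that by (intro cSup_upper) auto
qed

lemma phi_le: "phi x \<le> of_int k / 3 ^ r" if "x \<le> h r k"
proof -
  obtain l where l: "h 0 l \<le> x"
    using cell_exists[of 0] by blast
  show ?thesis
    unfolding phi_def
  proof (rule cSup_least)
    show "{real_of_int k / 3 ^ r | r k. h r k \<le> x} \<noteq> {}"
      using l by blast
    fix t assume "t \<in> {real_of_int k / 3 ^ r | r k. h r k \<le> x}"
    then obtain l s where "t = real_of_int l / 3 ^ s" "h s l \<le> x"
      by blast
    with that show "t \<le> real_of_int k / 3 ^ r"
      using h_le_h_iff[of s l r k] by simp
  qed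
qed

text \<open>The mesh tends to 0, so two consecutive endpoints of some level fit between
  \<open>x\<close> and \<open>y\<close>, and their distinct triadic values separate the
  images.\<close>

lemma strict_mono_phi: "strict_mono phi"
proof (rule strict_monoI)
  fix x y :: real
  assume "x < y"
  then have "(y - x) / (4 * L) > 0"
    using L_pos by simp
  then obtain r where "(1 / 2) ^ r < (y - x) / (4 * L)"
    using real_arch_pow_inv[of "(y - x) / (4 * L)" "1 / 2"] by auto
  then have r: "2 * L / 2 ^ r + 2 * L / 2 ^ r < y - x"
    using L_pos by (simp add: field_simps power_one_over)
  obtain k where k: "h r k \<le> x" "x < h r (k + 1)"
    using cell_exists by blast
  have "h r (k + 1 + 1) \<le> y"
    using k r gap_le[of r k] gap_le[of r "k + 1"] by linarith
  then have "of_int (k + 1 + 1) / 3 ^ r \<le> phi y"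
    by (rule phi_ge)
  moreover have "phi x \<le> of_int (k + 1) / 3 ^ r"
    using k by (intro phi_le) simp
  moreover have "real_of_int (k + 1) / 3 ^ r < of_int (k + 1 + 1) / 3 ^ r"
    by (intro divide_strict_right_mono) auto
  ultimately show "phi x < phi y"
    by linarith
qed

text \<open>The preimage of \<open>y\<close> is the supremum of the endpoints with triadic value at
  most \<open>y\<close>; a triadic rational strictly between \<open>phi x\<close> and
  \<open>y\<close> would contradict this choice on either side.\<close>

lemma surj_phi: "surj phi"
proof -
  have "\<exists>x. phi x = y" for y
  proof -
    define A where "A = {h r k | r k. of_int k / 3 ^ r \<le> y}"
    define x where "x = Sup A"
    have A_le: "a \<le> h r k" if "y \<le> of_int k / 3 ^ r" "a \<in> A" for a r k
    proof -
      obtain s l where "a = h s l" "of_int l / 3 ^ s \<le> y"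
        using \<open>a \<in> A\<close> unfolding A_def by blast
      then show ?thesis
        using that(1) h_le_h_iff[of s l r k] by simp
    qed
    have "h 0 \<lfloor>y\<rfloor> \<in> A"
      unfolding A_def by (auto intro!: exI[of _ 0] exI[of _ "\<lfloor>y\<rfloor>"])
    have "bdd_above A"
      using A_le[of "\<lceil>y\<rceil>" 0] by (intro bdd_aboveI[of _ "h 0 \<lceil>y\<rceil>"]) auto
    have "phi x \<ge> y"
    proof (rule ccontr)
      assume "\<not> ?thesis"
      then have "phi x < y" by simp
      then obtain r k where rk: "phi x < of_int k / 3 ^ r" "of_int k / 3 ^ r < y"
        by (rule triadic_dense)
      from rk(2) have "h r k \<in> A"
        unfolding A_def by (blast intro: less_imp_le)
      then have "h r k \<le> x"
        unfolding x_def using \<open>bdd_above A\<close> by (rule cSup_upper)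
      from phi_ge[OF this] rk(1) show False by simp
    qed
    moreover have "phi x \<le> y"
    proof (rule ccontr)
      assume "\<not> ?thesis"
      then have "y < phi x" by simp
      then obtain r k where rk: "y < of_int k / 3 ^ r" "of_int k / 3 ^ r < phi x"
        by (rule triadic_dense)
      have "x \<le> h r k"
        unfolding x_def
      proof (rule cSup_least)
        show "A \<noteq> {}"
          using \<open>h 0 \<lfloor>y\<rfloor> \<in> A\<close> by blast
      qed (rule A_le[OF less_imp_le[OF rk(1)]])
      from phi_le[OF this] rk(2) show False by simp
    qed
    ultimately show ?thesis
      by (intro exI[of _ x]) simp
  qed
  then show ?thesis
    unfolding surj_def by metis
qed

text \<open>The cell indices of \<open>x\<close> serve as the triadic address of its image, and a
  digit 1 means that the coordinate lies in a middle piece.\<close>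

lemma phi_image_in_menger:
  fixes x :: "real ^ 'd"
  assumes bound: "\<And>i. \<bar>x $ i\<bar> < L"
    and few: "\<And>r. card {i. \<exists>k. h (Suc r) (3 * k + 1) \<le> x $ i \<and> x $ i \<le> h (Suc r) (3 * k + 2)} \<le> n"
  shows "(\<chi> i. phi (x $ i)) \<in> menger_continuum n"
proof -
  define N where "N r i = (SOME k. h r k \<le> x $ i \<and> x $ i < h r (k + 1))" for r i
  have N: "h r (N r i) \<le> x $ i" "x $ i < h r (N r i + 1)" for r i
    using someI_ex[OF cell_exists[of r "x $ i"]] unfolding N_def by auto
  \<comment> \<open>Bracketing \<open>x $ i\<close> by endpoints of one level brackets the cell
    index. With \<open>-L\<close> and \<open>L\<close> this forces index 0; with the ends of a
    parent cell it forces one of its three children.\<close>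
  have N_unique: "k < N r i + 1" "N r i < l" if "h r k \<le> x $ i" "x $ i < h r l" for r i k l
    using strict_mono_less[OF strict_mono_h[of r]] N[where r = r and i = i] that by (meson le_less_trans)+
  show ?thesis
  proof (rule menger_continuumI[where N = N])
    fix r i
    show "N 0 i = 0"
      using N_unique[where r = 0 and k = 0 and i = i and l = 1] bound[of i] by (simp add: start abs_less_iff)
    have "h (Suc r) (3 * N r i) \<le> x $ i" "x $ i < h (Suc r) (3 * (N r i + 1))"
      using N[where r = r and i = i] unfolding refine by auto
    from N_unique[OF this] show "N (Suc r) i div 3 = N r i"
      by presburger
    show "of_int (N r i) / 3 ^ r \<le> (\<chi> i. phi (x $ i)) $ i"
      using N phi_ge by simp
    show "(\<chi> i. phi (x $ i)) $ i \<le> (of_int (N r i) + 1) / 3 ^ r"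
      using phi_le[of "x $ i" r "N r i + 1"] N[where r = r and i = i] by simp
  next
    fix r
    have "{i. N (Suc r) i mod 3 = 1}
        \<subseteq> {i. \<exists>k. h (Suc r) (3 * k + 1) \<le> x $ i \<and> x $ i \<le> h (Suc r) (3 * k + 2)}"
    proof safe
      fix i assume "N (Suc r) i mod 3 = 1"
      then have eq: "N (Suc r) i = 3 * (N (Suc r) i div 3) + 1"
        by presburger
      show "\<exists>k. h (Suc r) (3 * k + 1) \<le> x $ i \<and> x $ i \<le> h (Suc r) (3 * k + 2)"
        using N[where r = "Suc r" and i = i] eq
        by (intro exI[of _ "N (Suc r) i div 3"]) (metis add.assoc less_imp_le one_add_one)
    qed
    then show "card {i. N (Suc r) i mod 3 = 1} \<le> n"
      by (intro order_trans[OF card_mono few]) auto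
  qed
qed

end

section \<open>Coordinatewise homeomorphisms and their isotopies\<close>

text \<open>The inverse of an increasing bijection of the line is again monotone and surjective, so
  one continuity argument serves both directions.\<close>

lemma coordinatewise_homeomorphism:
  fixes f :: "'d::finite \<Rightarrow> real \<Rightarrow> real"
  assumes mono: "\<And>i. strict_mono (f i)" and surj: "\<And>i. surj (f i)"
  shows "homeomorphism UNIV UNIV (\<lambda>x. \<chi> i. f i (x $ i)) (\<lambda>x. \<chi> i. inv (f i) (x $ i))"
proof -
  have inj: "inj (f i)" for i
    using mono strict_mono_imp_inj_on by blast
  have "mono (inv (f i))" for i
    using mono[of i] surj[of i]
    by (intro monoI) (metis strict_mono_less_eq surj_f_inv_f)
  then have inv_cont: "continuous_on UNIV (inv (f i))" for i
    using surj_imp_continuous_on inj_imp_surj_inv[OF inj] by blast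
  have f_cont: "continuous_on UNIV (f i)" for i
    using surj_imp_continuous_on mono surj strict_mono_mono by blast
  have nth: "continuous_on UNIV (\<lambda>x :: real ^ 'd. x $ i)" for i
    by (intro continuous_intros)
  have cont: "continuous_on UNIV (\<lambda>x :: real ^ 'd. f i (x $ i))"
    "continuous_on UNIV (\<lambda>x :: real ^ 'd. inv (f i) (x $ i))" for i
    by (rule continuous_on_compose2[OF f_cont nth] continuous_on_compose2[OF inv_cont nth], simp)+
  show ?thesis
  proof (rule homeomorphismI)
    show "(\<chi> i. inv (f i) ((\<chi> i. f i (x $ i)) $ i)) = x" for x
      using inj by (simp add: inv_f_f)
    show "(\<chi> i. f i ((\<chi> i. inv (f i) (x $ i)) $ i)) = x" for x
      using surj by (simp add: surj_f_inv_f)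
  qed (use cont in \<open>auto intro: continuous_on_vec_lambda\<close>)
qed

text \<open>Strictness comes from the identity if \<open>t = 0\<close> and from \<open>f\<close>
  otherwise; surjectivity is the intermediate value theorem.\<close>

lemma convex_combination_with_id:
  fixes f :: "real \<Rightarrow> real"
  assumes "strict_mono f" "surj f" and t: "t \<in> {0..1}"
  shows "strict_mono (\<lambda>x. (1 - t) * x + t * f x)" (is "strict_mono ?g")
    and "surj (\<lambda>x. (1 - t) * x + t * f x)"
proof -
  show "strict_mono ?g"
  proof (rule strict_monoI)
    fix x y :: real
    assume "x < y"
    then have "f x < f y"
      using assms strict_monoD by blast
    show "?g x < ?g y"
    proof (cases "t = 0")
      case False
      have "(1 - t) * x \<le> (1 - t) * y" "t * f x < t * f y"
        using t False \<open>x < y\<close> \<open>f x < f y\<close> by (auto intro: mult_left_mono)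
      then show ?thesis by linarith
    qed (use \<open>x < y\<close> in simp)
  qed
  have cont: "continuous_on UNIV f"
    using assms surj_imp_continuous_on strict_mono_mono by blast
  \<comment> \<open>Between \<open>y\<close> and a preimage \<open>z\<close> of \<open>y\<close>
    under \<open>f\<close>, both the identity and \<open>f\<close> pass from values at most
    \<open>y\<close> to values at least \<open>y\<close>, and so does their combination.\<close>
  have "\<exists>x. ?g x = y" for y
  proof -
    obtain z where z: "f z = y"
      using \<open>surj f\<close> by (metis surjD)
    have f_mono: "a \<le> b \<Longrightarrow> f a \<le> f b" for a b
      using \<open>strict_mono f\<close> by (simp add: strict_mono_less_eq)
    have "f (min y z) \<le> y" "y \<le> f (max y z)"
      using z f_mono[of "min y z" z] f_mono[of z "max y z"] by auto
    then have "(1 - t) * min y z + t * f (min y z) \<le> (1 - t) * y + t * y"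
      "(1 - t) * y + t * y \<le> (1 - t) * max y z + t * f (max y z)"
      using t by (auto intro!: add_mono mult_left_mono)
    then have "?g (min y z) \<le> y" "y \<le> ?g (max y z)"
      by (simp_all add: algebra_simps)
    moreover have "continuous_on {min y z..max y z} ?g"
      using cont by (intro continuous_intros) (auto intro: continuous_on_subset)
    ultimately show ?thesis
      using IVT'[of ?g "min y z" y "max y z"] by (meson min_le_iff_disj max.coboundedI1 order_refl)
  qed
  then show "surj ?g"
    unfolding surj_def by metis
qed

text \<open>The straight-line homotopy from the identity works: each of its stages is again an
  increasing bijection in every coordinate.\<close>

lemma ambient_isotopic_coordinatewise:
  fixes f :: "'d::finite \<Rightarrow> real \<Rightarrow> real"
  assumes mono: "\<And>i. strict_mono (f i)" and surj: "\<And>i. surj (f i)"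
  shows "ambient_isotopic K ((\<lambda>x. \<chi> i. f i (x $ i)) ` K)"
proof -
  define H where "H p = (\<chi> i. (1 - snd p) * (fst p $ i) + snd p * f i (fst p $ i))"
    for p :: "(real ^ 'd) \<times> real"
  have cont: "continuous_on UNIV (f i)" for i
    using surj_imp_continuous_on mono surj strict_mono_mono by blast
  have "continuous_on (UNIV \<times> {0..1}) (\<lambda>p :: (real ^ 'd) \<times> real. f i (fst p $ i))" for i
    by (rule continuous_on_compose2[OF cont]) (auto intro!: continuous_intros)
  then have "continuous_on (UNIV \<times> {0..1}) H"
    unfolding H_def by (intro continuous_on_vec_lambda continuous_intros)
  moreover have "\<exists>g. homeomorphism UNIV UNIV (\<lambda>x. H (x, t)) g" if "t \<in> {0..1}" for t
    using coordinatewise_homeomorphism[of "\<lambda>i x. (1 - t) * x + t * f i x"]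
      convex_combination_with_id[OF mono surj that] by (auto simp: H_def)
  moreover have "H (x, 0) = x" for x
    by (simp add: H_def vec_eq_iff)
  moreover have "(\<lambda>x. H (x, 1)) ` K = (\<lambda>x. \<chi> i. f i (x $ i)) ` K"
    by (simp add: H_def)
  ultimately show ?thesis
    unfolding ambient_isotopic_def by blast
qed

section \<open>Moving the knot into the Menger continuum\<close>

theorem corollary2:
  fixes n :: nat
    and f :: "real ^ 'm \<Rightarrow> real ^ 'd"
    and K :: "(real ^ 'd) set"
  assumes "n \<ge> 1"
    and "CARD('m) = n + 1"
    and "CARD('d) = n + 2"
    and "smooth_sphere_embedding f"
    and "K = f ` sphere 0 1"
  shows "\<exists>K'. K' \<subseteq> menger_continuum n \<and>
              K' homeomorphic sphere (0 :: real ^ 'm) 1 \<and>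
              ambient_isotopic K K'"
proof -
  \<comment> \<open>Values of \<open>f\<close> off the sphere are arbitrary, so differentiability at
    points of the sphere is taken from the extension \<open>F\<close>.\<close>
  obtain U F where "open U" "sphere 0 1 \<subseteq> U" "smooth_on U F"
    and F: "\<And>x. x \<in> sphere 0 1 \<Longrightarrow> F x = f x"
    using \<open>smooth_sphere_embedding f\<close> unfolding smooth_sphere_embedding_def by blast
  have "higher_differentiable_on (Suc 0) U F"
    using \<open>smooth_on U F\<close> unfolding smooth_on_def by blast
  then have diff: "F differentiable (at x)" if "x \<in> sphere 0 1" for x
    using that \<open>sphere 0 1 \<subseteq> U\<close> by auto
  obtain g where g: "homeomorphism (sphere 0 1) K f g"
    using assms(4,5) unfolding smooth_sphere_embedding_def by blast
  have "CARD('d) = CARD('m) + 1"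
    using assms by simp
  from generic_translate_avoids_countable[OF this diff countable_rat]
  obtain v where v: "\<exists>j. j \<noteq> i \<and> F x $ j + v $ j \<notin> \<rat>" if "x \<in> sphere 0 1" for x i
    by blast
  define T where "T = (\<lambda>x. x + v) ` K"
  have few: "card {i. x $ i \<in> \<rat>} \<le> n" if "x \<in> T" for x
  proof -
    obtain s where "s \<in> sphere 0 1" "x = f s + v"
      using \<open>x \<in> T\<close> unfolding T_def assms(5) by blast
    with F have s: "s \<in> sphere 0 1" "x = F s + v"
      by simp_all
    \<comment> \<open>Using this twice, the second time excluding the first index found, yields two
      irrational coordinates; at most \<open>n\<close> of the \<open>n + 2\<close> remain
      rational.\<close>
    then have irrational: "\<exists>j. j \<noteq> i \<and> x $ j \<notin> \<rat>" for i
      using v[OF s(1)] by simp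
    then obtain i where i: "x $ i \<notin> \<rat>"
      by blast
    obtain j where j: "j \<noteq> i" "x $ j \<notin> \<rat>"
      using irrational by blast
    have "card {i. x $ i \<in> \<rat>} \<le> card (UNIV - {i, j})"
      using i j by (intro card_mono) auto
    also have "\<dots> = n"
      using j assms(3) by (subst card_Diff_subset) auto
    finally show ?thesis .
  qed
  have "compact K"
    using compact_continuous_image[OF homeomorphism_cont1[OF g] compact_sphere]
    by (simp add: assms(5))
  then have "compact T"
    unfolding T_def by (intro compact_continuous_image continuous_intros)
  then have "bounded T"
    by (rule compact_imp_bounded)
  then obtain B where B: "\<And>x. x \<in> T \<Longrightarrow> norm x \<le> B"
    unfolding bounded_iff by blast
  \<comment> \<open>Rationality of \<open>L\<close> makes the initial endpoints rational, and
    \<open>L > B\<close> puts all coordinates of points of \<open>T\<close> strictly inside the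
    initial cell.\<close>
  obtain L :: real where L: "L \<in> \<rat>" "max 0 B < L"
    using Rats_dense_in_real[of "max 0 B" "max 0 B + 1"] by auto
  then have "L > 0" by simp
  obtain h where h: "\<And>k. h 0 k = 2 * L * of_int k - L"
    "\<And>r k. h (Suc r) (3 * k) = h r k"
    "\<And>r k. h r k < h r (k + 1)"
    "\<And>r k. h r (k + 1) - h r k \<le> 2 * L / 2 ^ r"
    and thin: "\<And>r x. x \<in> T \<Longrightarrow>
      card {i. \<exists>k. h (Suc r) (3 * k + 1) \<le> x $ i \<and> x $ i \<le> h (Suc r) (3 * k + 2)} \<le> n"
    using subdivision_sequence[OF \<open>compact T\<close> few \<open>L \<in> \<rat>\<close> \<open>L > 0\<close>] by blast
  interpret triadic_subdivision h L
    by unfold_locales (use h \<open>L > 0\<close> in auto)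
  \<comment> \<open>Absorbing the translation into the coordinate maps lets a single isotopy start
    from \<open>K\<close> itself rather than from \<open>T\<close>.\<close>
  define psi where "psi i y = phi (y + v $ i)" for i y
  have psi_mono: "strict_mono (psi i)" for i
    using strict_mono_phi by (auto simp: psi_def strict_mono_def)
  have psi_surj: "surj (psi i)" for i
    unfolding surj_def
  proof
    fix y
    obtain z where "y = phi z"
      using surj_phi unfolding surj_def by blast
    then have "y = psi i (z - v $ i)"
      by (simp add: psi_def)
    then show "\<exists>z. y = psi i z" ..
  qed
  define Psi where "Psi = (\<lambda>x. \<chi> i. psi i (x $ i))"
  have "Psi ` K \<subseteq> menger_continuum n"
  proof
    fix y assume "y \<in> Psi ` K"
    then obtain z where z: "z \<in> K" "y = (\<chi> i. phi ((z + v) $ i))"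
      by (auto simp: Psi_def psi_def)
    define x where "x = z + v"
    have x: "x \<in> T" "y = (\<chi> i. phi (x $ i))"
      using z by (auto simp: T_def x_def)
    have "\<bar>x $ i\<bar> < L" for i
      using component_le_norm_cart[of x i] B[OF x(1)] L by simp
    then show "y \<in> menger_continuum n"
      using phi_image_in_menger[of x n] thin[OF x(1)] x(2) by simp
  qed
  moreover have "Psi ` K homeomorphic sphere (0 :: real ^ 'm) 1"
  proof -
    have "homeomorphism UNIV UNIV Psi (\<lambda>x. \<chi> i. inv (psi i) (x $ i))"
      unfolding Psi_def by (rule coordinatewise_homeomorphism[OF psi_mono psi_surj])
    then have "homeomorphism K (Psi ` K) Psi (\<lambda>x. \<chi> i. inv (psi i) (x $ i))"
      by (rule homeomorphism_of_subsets) auto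
    then have "sphere (0 :: real ^ 'm) 1 homeomorphic Psi ` K"
      using homeomorphism_compose[OF g] unfolding homeomorphic_def by blast
    then show ?thesis
      by (rule homeomorphic_sym[THEN iffD1])
  qed
  moreover have "ambient_isotopic K (Psi ` K)"
    unfolding Psi_def by (rule ambient_isotopic_coordinatewise[OF psi_mono psi_surj])
  ultimately show ?thesis by blast
qed

end
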